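(* Let $1\le n<m\le N$, let $\Phi\in\mathbb R^{N\times m}$ be a basis matrix and $S\in\mathbb R^{N\times n}$ a selection matrix such that $S^\top\Phi$ has full rank $n$. Let $\mathbf u\in\mathbb R^N$, and for $\mathbf z\in\mathcal N[S^\top\Phi]$ let $\tilde{\mathbf u}(\mathbf z)=\Phi(S^\top\Phi)^+S^\top\mathbf u+\Phi\mathbf z$. Then the optimization problem $$\hat{\mathbf z}=\operatorname*{arg\,min}_{\mathbf z\in\mathcal N[S^\top\Phi]}\|\tilde{\mathbf u}(\mathbf z)-\mathbf u\|^2$$ has a unique solution, given by $\hat{\mathbf z}=ZZ^\top\Phi^\top\mathbf u$, where $Z$ is a kernel matrix of $S^\top\Phi$.
   Context: A basis matrix $\Phi\in\mathbb R^{N\times m}$ is a real matrix with orthonormal columns, $\Phi^\top\Phi=\mathbb I_m$. A selection matrix $S\in\mathbb R^{N\times n}$ is a matrix $[\mathbf e_{i_1}|\cdots|\mathbf e_{i_n}]$ whose columns are standard basis vectors of $\mathbb R^N$ with distinct indices. $A^+$ is the Moore--Penrose pseudoinverse of $A$, $\mathcal N[A]$ is its null space, and $\|\cdot\|$ is the Euclidean norm. A kernel matrix $Z\in\mathbb R^{m\times(m-n)}$ is a matrix whose columns form an orthonormal basis of $\mathcal N[S^\top\Phi]$. *)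

theory Defs
  imports "HOL-Analysis.Analysis"
begin

text \<open>A matrix with \<open>r\<close> rows and \<open>c\<close> columns has type \<open>real^'c^'r\<close>.\<close>

definition basis_matrix :: "real^'m^'N \<Rightarrow> bool" where
  "basis_matrix \<Phi> \<longleftrightarrow> transpose \<Phi> ** \<Phi> = mat 1"

definition selection_matrix :: "real^'n^'N \<Rightarrow> bool" where
  "selection_matrix S \<longleftrightarrow> (\<exists>\<iota> :: 'n \<Rightarrow> 'N. inj \<iota> \<and> (\<forall>j. column j S = axis (\<iota> j) 1))"

definition null_space :: "real^'n^'m \<Rightarrow> (real^'n) set" where
  "null_space A = {x. A *v x = 0}"

text \<open>The columns are required to be orthonormal as an indexed family, so that they are
  pairwise distinct; together with the span condition they form an orthonormal basis.\<close>

definition kernel_matrix :: "real^'m^'n \<Rightarrow> real^'k^'m \<Rightarrow> bool" where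
  "kernel_matrix A Z \<longleftrightarrow>
     (\<forall>i j. column i Z \<bullet> column j Z = (if i = j then 1 else 0)) \<and>
     span (columns Z) = null_space A"

definition penrose_conditions :: "real^'n^'m \<Rightarrow> real^'m^'n \<Rightarrow> bool" where
  "penrose_conditions A X \<longleftrightarrow>
     A ** X ** A = A \<and> X ** A ** X = X \<and>
     transpose (A ** X) = A ** X \<and> transpose (X ** A) = X ** A"

definition pseudoinverse :: "real^'n^'m \<Rightarrow> real^'m^'n" where
  "pseudoinverse A = (THE X. penrose_conditions A X)"

text \<open>The four Penrose conditions determine exactly one matrix, so the definite description
  above is well defined for every matrix.\<close>

lemma penrose_conditions_unique:
  fixes A :: "real^'n^'m"
  assumes X: "penrose_conditions A X" and Y: "penrose_conditions A Y"
  shows "X = Y"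
proof -
  have x: "A ** X ** A = A" "X ** A ** X = X"
      "transpose (A ** X) = A ** X" "transpose (X ** A) = X ** A"
    and y: "A ** Y ** A = A" "Y ** A ** Y = Y"
      "transpose (A ** Y) = A ** Y" "transpose (Y ** A) = Y ** A"
    using X Y by (auto simp: penrose_conditions_def)
  have "A ** X = (A ** Y ** A) ** X" by (simp only: y)
  also have "\<dots> = transpose (A ** Y) ** transpose (A ** X)"
    by (simp only: x(3) y(3) matrix_mul_assoc)
  also have "\<dots> = transpose (A ** X ** A ** Y)"
    by (simp add: matrix_transpose_mul matrix_mul_assoc)
  also have "\<dots> = A ** Y" by (simp add: x y)
  finally have AX: "A ** X = A ** Y" .
  have "X ** A = X ** (A ** Y ** A)" by (simp only: y)
  also have "\<dots> = transpose (X ** A) ** transpose (Y ** A)"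
    by (simp only: x(4) y(4) matrix_mul_assoc)
  also have "\<dots> = transpose (Y ** (A ** X ** A))"
    by (simp add: matrix_transpose_mul matrix_mul_assoc)
  also have "\<dots> = Y ** A" by (simp add: x y)
  finally have XA: "X ** A = Y ** A" .
  have "X = X ** (A ** X)" by (simp add: x matrix_mul_assoc)
  also have "\<dots> = Y ** A ** Y" by (simp add: AX XA matrix_mul_assoc)
  finally show ?thesis by (simp add: y)
qed

lemma penrose_conditions_exist:
  fixes A :: "real^'n^'m"
  shows "\<exists>X. penrose_conditions A X"
proof -
  note [simp del] = transpose_matrix_vector
  let ?T = "transpose A"
  have adj: "(A *v x) \<bullet> y = x \<bullet> (?T *v y)" for x y
    by (metis dot_lmul_matrix inner_commute transpose_matrix_vector)
  define R where "R y x \<longleftrightarrow> x \<in> range ((*v) ?T) \<and> ?T *v (A *v x - y) = 0" for y x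
  have ker: "A *v d = 0" if "?T *v (A *v d) = 0" for d
    using adj[of d "A *v d"] that by simp
  have uniq: "x = x'" if RR: "R y x" "R y x'" for y x x'
  proof -
    obtain a b where ab: "x = ?T *v a" "x' = ?T *v b"
      using RR by (auto simp: R_def)
    have "?T *v (A *v (x - x')) = 0"
      using that by (simp add: R_def matrix_vector_mult_diff_distrib)
    then have 0: "A *v (x - x') = 0" by (rule ker)
    have "(x - x') \<bullet> (x - x') = (x - x') \<bullet> (?T *v (a - b))"
      by (simp add: ab matrix_vector_mult_diff_distrib)
    also have "\<dots> = 0" using adj[of "x - x'" "a - b"] 0 by simp
    finally show ?thesis by simp
  qed
  have sub: "subspace (range ((*v) B))" for B :: "real^'a^'b"
    by (intro linear_subspace_image) auto
  have ex: "\<exists>x. R y x" for y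
  proof -
    obtain p q where pq: "p \<in> range ((*v) A)" "\<And>w. w \<in> range ((*v) A) \<Longrightarrow> orthogonal q w"
        "y = p + q"
      using orthogonal_subspace_decomp_exists[of "range ((*v) A)" y] span_eq_iff[THEN iffD2, OF sub]
      by metis
    obtain w where w: "p = A *v w" using pq by auto
    obtain r s where rs: "r \<in> range ((*v) ?T)" "\<And>v. v \<in> range ((*v) ?T) \<Longrightarrow> orthogonal s v"
        "w = r + s"
      using orthogonal_subspace_decomp_exists[of "range ((*v) ?T)" w] span_eq_iff[THEN iffD2, OF sub]
      by metis
    have "(A *v s) \<bullet> (A *v s) = 0"
      using rs(2)[of "?T *v (A *v s)"] adj[of s "A *v s"] by (simp add: orthogonal_def)
    then have "p = A *v r" using w rs by (simp add: matrix_vector_right_distrib)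
    moreover have "?T *v (- q) = 0"
    proof -
      have "(?T *v q) \<bullet> (?T *v q) = (A *v (?T *v q)) \<bullet> q" by (simp add: adj)
      also have "\<dots> = 0"
        using pq(2)[of "A *v (?T *v q)"] by (simp add: orthogonal_def inner_commute)
      finally have "?T *v (0 - q) = 0"
        by (simp only: matrix_vector_mult_diff_distrib) simp
      then show ?thesis by simp
    qed
    ultimately have "R y r"
      using rs(1) pq(3) by (simp add: R_def matrix_vector_mult_diff_distrib matrix_vector_right_distrib)
    then show ?thesis ..
  qed
  define f where "f y = (SOME x. R y x)" for y
  have f: "R y (f y)" for y unfolding f_def using ex by (rule someI_ex)
  have "linear f"
  proof (rule linearI)
    fix a b
    show "f (a + b) = f a + f b"
    proof (rule uniq[OF f])
      show "R (a + b) (f a + f b)"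
        using f[of a] f[of b] subspace_add[OF sub, of "f a" ?T "f b"]
        by (simp add: R_def matrix_vector_mult_diff_distrib matrix_vector_right_distrib)
    qed
  next
    fix c a
    show "f (c *\<^sub>R a) = c *\<^sub>R f a"
    proof (rule uniq[OF f])
      show "R (c *\<^sub>R a) (c *\<^sub>R f a)"
        using f[of a] subspace_mul[OF sub, of "f a" ?T c]
        by (simp add: R_def matrix_vector_mult_diff_distrib matrix_vector_mult_scaleR)
    qed
  qed
  then have X: "matrix f *v y = f y" for y by simp
  let ?X = "matrix f"
  have AfA: "A *v f (A *v v) = A *v v" for v
    using ker[of "f (A *v v) - v"] f[of "A *v v"]
    by (simp add: R_def matrix_vector_mult_diff_distrib)
  have fAf: "f (A *v f y) = f y" for y
    using f[of y] by (intro uniq[OF f]) (simp add: R_def)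
  have symI: "transpose B = B" if "\<And>x y. (B *v x) \<bullet> y = (B *v x) \<bullet> (B *v y)" for B :: "real^'a^'a"
  proof -
    have "(transpose B *v y) \<bullet> x = (B *v y) \<bullet> x" for x y
    proof -
      have "(transpose B *v y) \<bullet> x = (B *v x) \<bullet> y"
        by (metis dot_lmul_matrix inner_commute transpose_matrix_vector)
      also have "\<dots> = (B *v y) \<bullet> x"
        using that[of x y] that[of y x] by (simp add: inner_commute)
      finally show ?thesis .
    qed
    then have "transpose B *v y = B *v y" for y
      using vector_eq_rdot[of "transpose B *v y" "B *v y"] by blast
    then show ?thesis by (simp add: matrix_eq)
  qed
  have "transpose (A ** ?X) = A ** ?X"
  proof (rule symI)
    fix x y
    have "(A *v f x) \<bullet> (A *v f y - y) = 0"
      using f[of y] by (simp add: adj R_def)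
    then show "((A ** ?X) *v x) \<bullet> y = ((A ** ?X) *v x) \<bullet> ((A ** ?X) *v y)"
      by (simp add: X inner_diff_right flip: matrix_vector_mul_assoc)
  qed
  moreover have "transpose (?X ** A) = ?X ** A"
  proof (rule symI)
    fix x y
    obtain a where "f (A *v x) = ?T *v a" using f[of "A *v x"] by (auto simp: R_def)
    then have "f (A *v x) \<bullet> (f (A *v y) - y) = (A *v (f (A *v y) - y)) \<bullet> a"
      using adj[of "f (A *v y) - y" a] by (metis inner_commute)
    also have "\<dots> = 0" by (simp add: AfA matrix_vector_mult_diff_distrib)
    finally show "((?X ** A) *v x) \<bullet> y = ((?X ** A) *v x) \<bullet> ((?X ** A) *v y)"
      by (simp add: X inner_diff_right flip: matrix_vector_mul_assoc)
  qed
  moreover have "A ** ?X ** A = A" "?X ** A ** ?X = ?X"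
    by (simp_all add: matrix_eq X AfA fAf flip: matrix_vector_mul_assoc)
  ultimately show ?thesis unfolding penrose_conditions_def by blast
qed

lemma penrose_conditions_pseudoinverse: "penrose_conditions A (pseudoinverse A)"
  unfolding pseudoinverse_def
  by (rule theI') (use penrose_conditions_exist penrose_conditions_unique in blast)

definition reconstruction ::
    "real^'m^'N \<Rightarrow> real^'n^'N \<Rightarrow> real^'N \<Rightarrow> real^'m \<Rightarrow> real^'N" where
  "reconstruction \<Phi> S u z =
     (\<Phi> ** pseudoinverse (transpose S ** \<Phi>) ** transpose S) *v u + \<Phi> *v z"

end

theory Submission
  imports Defs
begin

text \<open>Everything rests on two orthogonality relations. Write \<open>A = S\<^sup>T \<Phi>\<close>. The range of
  \<open>A\<^sup>+\<close> is the row space of \<open>A\<close>, hence orthogonal to \<open>\<N>[A]\<close>, and \<open>\<Phi>\<close> preserves inner products.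
  So the fixed part \<open>\<Phi> A\<^sup>+ S\<^sup>T u\<close> of the reconstruction does not interact with the free part
  \<open>\<Phi> z\<close>, and the problem becomes that of approximating \<open>\<Phi>\<^sup>T u\<close> by a point of the
  subspace \<open>\<N>[A]\<close>. Concretely, if \<open>p\<close> is the orthogonal projection of \<open>\<Phi>\<^sup>T u\<close> onto \<open>\<N>[A]\<close>,
  then the residual of \<open>p\<close> is orthogonal to \<open>\<Phi> w\<close> for all \<open>w \<in> \<N>[A]\<close>, and Pythagoras gives
  \<open>\<parallel>u(z) - u\<parallel>\<^sup>2 = \<parallel>u(p) - u\<parallel>\<^sup>2 + \<parallel>z - p\<parallel>\<^sup>2\<close> (lemma \<open>reconstruction_error_pythagoras\<close>), where
  \<open>u(z)\<close> is the reconstruction. Thus \<open>p\<close> is the one and only minimizer. The projection always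
  exists, and for any kernel matrix \<open>Z\<close> it equals \<open>Z Z\<^sup>T \<Phi>\<^sup>T u\<close>
  (lemma \<open>kernel_matrix_projection\<close>).\<close>

lemma inner_matrix_vector_transpose:
  fixes A :: "real^'n^'m"
  shows "(A *v x) \<bullet> y = x \<bullet> (transpose A *v y)"
  by (metis dot_lmul_matrix inner_commute transpose_matrix_vector)

lemma subspace_null_space: "subspace (null_space A)"
  by (auto simp: subspace_def null_space_def matrix_vector_right_distrib matrix_vector_mult_scaleR)

lemma basis_matrix_inner:
  assumes "basis_matrix \<Phi>"
  shows "(\<Phi> *v x) \<bullet> (\<Phi> *v y) = x \<bullet> y"
  using assms
  by (simp add: inner_matrix_vector_transpose basis_matrix_def matrix_vector_mul_assoc
           del: transpose_matrix_vector)

text \<open>By the Penrose conditions \<open>A\<^sup>+ = (A\<^sup>+ A) A\<^sup>+\<close>, and the symmetric matrix \<open>A\<^sup>+ A\<close>, moved to the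
  other side of the inner product, annihilates the null space.\<close>

lemma pseudoinverse_orthogonal_null_space:
  assumes "w \<in> null_space A"
  shows "(pseudoinverse A *v y) \<bullet> w = 0"
proof -
  let ?X = "pseudoinverse A"
  have p: "?X ** A ** ?X = ?X" "transpose (?X ** A) = ?X ** A"
    using penrose_conditions_pseudoinverse[of A] by (auto simp: penrose_conditions_def)
  have "(?X *v y) \<bullet> w = ((?X ** A) *v (?X *v y)) \<bullet> w"
    by (simp add: matrix_vector_mul_assoc p(1))
  also have "\<dots> = (?X *v y) \<bullet> ((?X ** A) *v w)"
    by (simp only: inner_matrix_vector_transpose p(2))
  also have "\<dots> = 0"
    using assms by (simp add: null_space_def flip: matrix_vector_mul_assoc)
  finally show ?thesis .
qed

text \<open>The hypotheses on \<open>p\<close> say that it is the orthogonal projection of \<open>\<Phi>\<^sup>T u\<close> onto the null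
  space. Together with the orthogonality of the pseudoinverse's range they make the mixed term in
  the expansion of the squared norm vanish.\<close>

lemma reconstruction_error_pythagoras:
  fixes \<Phi> :: "real^'m^'N" and S :: "real^'n^'N"
  assumes \<Phi>: "basis_matrix \<Phi>"
    and p: "p \<in> null_space (transpose S ** \<Phi>)"
    and orth: "\<And>w. w \<in> null_space (transpose S ** \<Phi>) \<Longrightarrow> (transpose \<Phi> *v u - p) \<bullet> w = 0"
    and z: "z \<in> null_space (transpose S ** \<Phi>)"
  shows "(norm (reconstruction \<Phi> S u z - u))\<^sup>2
    = (norm (reconstruction \<Phi> S u p - u))\<^sup>2 + (norm (z - p))\<^sup>2"
proof -
  let ?A = "transpose S ** \<Phi>"
  define a where "a = pseudoinverse ?A *v (transpose S *v u)"
  define w where "w = z - p"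
  have w: "w \<in> null_space ?A"
    unfolding w_def by (intro subspace_diff subspace_null_space z p)
  have rec: "reconstruction \<Phi> S u x = \<Phi> *v (a + x)" for x
    by (simp add: reconstruction_def a_def matrix_vector_right_distrib
             del: transpose_matrix_vector flip: matrix_vector_mul_assoc)
  have split: "reconstruction \<Phi> S u z - u = (reconstruction \<Phi> S u p - u) + \<Phi> *v w"
    by (simp add: rec w_def matrix_vector_right_distrib matrix_vector_mult_diff_distrib)
  have "(reconstruction \<Phi> S u p - u) \<bullet> (\<Phi> *v w) = (a + p) \<bullet> w - (transpose \<Phi> *v u) \<bullet> w"
    unfolding rec inner_diff_left basis_matrix_inner[OF \<Phi>]
    using inner_matrix_vector_transpose[of \<Phi> w u] by (simp only: inner_commute)
  also have "\<dots> = a \<bullet> w - (transpose \<Phi> *v u - p) \<bullet> w"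
    by (simp only: inner_add_left inner_diff_left)
  also have "\<dots> = 0"
    using orth[OF w] pseudoinverse_orthogonal_null_space[OF w] by (simp only: a_def)
  finally have "orthogonal (reconstruction \<Phi> S u p - u) (\<Phi> *v w)"
    by (simp only: orthogonal_def)
  moreover have "norm (\<Phi> *v w) = norm w"
    using basis_matrix_inner[OF \<Phi>] by (simp only: norm_eq_sqrt_inner)
  ultimately show ?thesis
    unfolding split by (simp only: norm_add_Pythagorean w_def)
qed

lemma is_arg_min_reconstruction_error_iff:
  fixes \<Phi> :: "real^'m^'N" and S :: "real^'n^'N"
  assumes \<Phi>: "basis_matrix \<Phi>"
    and p: "p \<in> null_space (transpose S ** \<Phi>)"
    and orth: "\<And>w. w \<in> null_space (transpose S ** \<Phi>) \<Longrightarrow> (transpose \<Phi> *v u - p) \<bullet> w = 0"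
  shows "is_arg_min (\<lambda>z. (norm (reconstruction \<Phi> S u z - u))\<^sup>2)
           (\<lambda>z. z \<in> null_space (transpose S ** \<Phi>)) z \<longleftrightarrow> z = p"
proof -
  have eq: "(norm (reconstruction \<Phi> S u y - u))\<^sup>2
      = (norm (reconstruction \<Phi> S u p - u))\<^sup>2 + (norm (y - p))\<^sup>2"
    if "y \<in> null_space (transpose S ** \<Phi>)" for y
    using \<Phi> p orth that by (rule reconstruction_error_pythagoras)
  show ?thesis
  proof
    assume "is_arg_min (\<lambda>z. (norm (reconstruction \<Phi> S u z - u))\<^sup>2)
           (\<lambda>z. z \<in> null_space (transpose S ** \<Phi>)) z"
    then have "z \<in> null_space (transpose S ** \<Phi>)"
      and "(norm (reconstruction \<Phi> S u z - u))\<^sup>2 \<le> (norm (reconstruction \<Phi> S u p - u))\<^sup>2"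
      using p by (auto simp: is_arg_min_linorder)
    then have "(norm (z - p))\<^sup>2 \<le> 0"
      using eq[of z] by linarith
    then show "z = p" by simp
  next
    have "(norm (reconstruction \<Phi> S u p - u))\<^sup>2 \<le> (norm (reconstruction \<Phi> S u y - u))\<^sup>2"
      if "y \<in> null_space (transpose S ** \<Phi>)" for y
      by (subst eq[OF that]) simp
    moreover assume "z = p"
    ultimately show "is_arg_min (\<lambda>z. (norm (reconstruction \<Phi> S u z - u))\<^sup>2)
           (\<lambda>z. z \<in> null_space (transpose S ** \<Phi>)) z"
      using p by (simp add: is_arg_min_linorder)
  qed
qed

lemma null_space_projection_exists:
  obtains p where "p \<in> null_space A" "\<And>w. w \<in> null_space A \<Longrightarrow> (v - p) \<bullet> w = 0"
proof -
  obtain p q where "p \<in> span (null_space A)" "\<And>w. w \<in> span (null_space A) \<Longrightarrow> orthogonal q w"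
      "v = p + q"
    using orthogonal_subspace_decomp_exists[of "null_space A" v] by metis
  then show ?thesis
    using that[of p] subspace_null_space[of A]
    by (simp add: span_eq_iff[THEN iffD2] orthogonal_def)
qed

text \<open>Orthonormal columns give \<open>Z\<^sup>T Z = I\<close>, so \<open>Z\<^sup>T (v - Z Z\<^sup>T v) = 0\<close>: the residual is orthogonal
  to every column of \<open>Z\<close>, hence to their span.\<close>

lemma kernel_matrix_projection:
  assumes Z: "kernel_matrix A Z"
  shows "(Z ** transpose Z) *v v \<in> null_space A"
    and "w \<in> null_space A \<Longrightarrow> (v - (Z ** transpose Z) *v v) \<bullet> w = 0"
proof -
  have span: "span (columns Z) = null_space A"
    using Z by (simp add: kernel_matrix_def)
  have ZZ: "transpose Z ** Z = mat 1"
    unfolding matrix_mult_transpose_dot_column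
    using Z by (simp add: kernel_matrix_def mat_def)
  show "(Z ** transpose Z) *v v \<in> null_space A"
    using matrix_vector_mult_in_columnspace[of Z "transpose Z *v v"] span
    by (simp add: matrix_vector_mul_assoc del: transpose_matrix_vector)
  let ?r = "v - (Z ** transpose Z) *v v"
  have "transpose Z *v ?r = transpose Z *v v - (transpose Z ** Z) *v (transpose Z *v v)"
    by (simp only: matrix_vector_mult_diff_distrib matrix_vector_mul_assoc matrix_mul_assoc)
  then have r: "transpose Z *v ?r = 0"
    by (simp only: ZZ matrix_vector_mul_lid diff_self)
  have "orthogonal ?r c" if "c \<in> columns Z" for c
  proof -
    obtain j where c: "c = Z *v axis j 1"
      using \<open>c \<in> columns Z\<close> by (auto simp: columns_def matrix_vector_mult_basis)
    have "c \<bullet> ?r = axis j 1 \<bullet> (transpose Z *v ?r)"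
      unfolding c by (rule inner_matrix_vector_transpose)
    then show ?thesis
      by (simp only: r inner_zero_right orthogonal_def inner_commute[of ?r])
  qed
  then show "?r \<bullet> w = 0" if "w \<in> null_space A"
    using orthogonal_to_span[of w "columns Z" ?r] that span by (simp add: orthogonal_def)
qed

theorem lemma4:
  fixes \<Phi> :: "real^'m^'N" and S :: "real^'n^'N" and u :: "real^'N"
  assumes "1 \<le> CARD('n)" and "CARD('n) < CARD('m)" and "CARD('m) \<le> CARD('N)"
    and "CARD('k::finite) = CARD('m) - CARD('n)"
    and "basis_matrix \<Phi>"
    and "selection_matrix S"
    and "rank (transpose S ** \<Phi>) = CARD('n)"
  shows "(\<exists>!z. is_arg_min (\<lambda>z. (norm (reconstruction \<Phi> S u z - u))\<^sup>2)
                 (\<lambda>z. z \<in> null_space (transpose S ** \<Phi>)) z) \<and>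
         (\<forall>Z :: real^'k^'m. kernel_matrix (transpose S ** \<Phi>) Z \<longrightarrow>
            is_arg_min (\<lambda>z. (norm (reconstruction \<Phi> S u z - u))\<^sup>2)
              (\<lambda>z. z \<in> null_space (transpose S ** \<Phi>))
              ((Z ** transpose Z ** transpose \<Phi>) *v u))"
proof (intro conjI allI impI)
  obtain p where p: "p \<in> null_space (transpose S ** \<Phi>)"
    "\<And>w. w \<in> null_space (transpose S ** \<Phi>) \<Longrightarrow> (transpose \<Phi> *v u - p) \<bullet> w = 0"
    using null_space_projection_exists[of "transpose S ** \<Phi>" "transpose \<Phi> *v u"] by blast
  show "\<exists>!z. is_arg_min (\<lambda>z. (norm (reconstruction \<Phi> S u z - u))\<^sup>2)
          (\<lambda>z. z \<in> null_space (transpose S ** \<Phi>)) z"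
    by (simp add: is_arg_min_reconstruction_error_iff[OF \<open>basis_matrix \<Phi>\<close> p])
next
  fix Z :: "real^'k^'m"
  assume "kernel_matrix (transpose S ** \<Phi>) Z"
  note proj = kernel_matrix_projection[OF this, where v = "transpose \<Phi> *v u"]
  have eq: "(Z ** transpose Z ** transpose \<Phi>) *v u = (Z ** transpose Z) *v (transpose \<Phi> *v u)"
    by (simp only: matrix_vector_mul_assoc)
  show "is_arg_min (\<lambda>z. (norm (reconstruction \<Phi> S u z - u))\<^sup>2)
          (\<lambda>z. z \<in> null_space (transpose S ** \<Phi>)) ((Z ** transpose Z ** transpose \<Phi>) *v u)"
    unfolding eq
    by (simp only: is_arg_min_reconstruction_error_iff[OF \<open>basis_matrix \<Phi>\<close> proj])
qed

end
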